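(* Let $\alpha>0$ and let $V$ be a finite set. (Necessity) Let $d:\mathbb N\times\mathbb R_+\to\mathbb R$ satisfy $d(0,\cdot)\equiv1$. Suppose that $D(\xi,z)=\prod_{x}d(\xi_x,z_x)$ is a factorized duality function between the process $\mathrm{SIP}(\alpha)$ (variable $\xi\in\mathbb N^V$) and the process $\mathrm{BEP}(\alpha)$ (variable $z\in\mathbb R_+^V$), that the single-edge generators of $\mathrm{SIP}(\alpha)$ and $\mathrm{BEP}(\alpha)$ are also dual with this factorized duality function, and that for every $\lambda>0$ and every $\xi\in\mathbb N^V$ the function $D(\xi,\cdot)$ is integrable with respect to the stationary product measure $\otimes_{x\in V}\nu_\lambda$ of $\mathrm{BEP}(\alpha)$, where $\nu_\lambda(dz)=z^{\alpha-1}e^{-\lambda z}\frac{\lambda^\alpha}{\Gamma(\alpha)}dz$. Then there exist $a,b\in\mathbb R$ such that $d(1,z)=a+bz$, and, for all $k\in\mathbb N$ and $\lambda>0$, $$\int_{\mathbb R_+}d(k,z)\frac{z^{\alpha-1}}{\Gamma(\alpha)}e^{-\lambda z}\,dz=(a\lambda+b\alpha)^k\lambda^{-\alpha-k},$$ so that $d(k,z)\frac{z^{\alpha-1}}{\Gamma(\alpha)}$ is the inverse Laplace transform of the right-hand side. Consequently, if $a=0$, $$d(k,z)=(b\alpha)^k\,\frac{z^k\,\Gamma(\alpha)}{\Gamma(\alpha+k)},$$ and if $a\neq0$, $$d(k,z)=a^k\;{}_1F_1\!\left(-k;\alpha;-\tfrac{b\alpha}{a}z\right).$$ In the case $a\cdot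 b<0$, the latter equals $a^k\frac{k!\,\Gamma(\alpha)}{\Gamma(\alpha+k)}L_k(z;\alpha-1,\mu)$ with $\mu=-\frac{b\alpha}{a}$, where $\{L_k(z;\alpha-1,\mu),\ k\in\mathbb N\}$ are the generalized Laguerre polynomials, orthogonal with respect to the Gamma distribution of scale parameter $\frac1\mu$ and shape parameter $\alpha$. (Sufficiency) Conversely, functions $d(k,z)$ of these forms are single-site duality functions between the generator $L$ of $\mathrm{SIP}(\alpha)$ and the generator $\mathscr L$ of $\mathrm{BEP}(\alpha)$: with $D(\xi,z)=\prod_{x\in V}d(\xi_x,z_x)$, one has $(LD(\cdot,z))(\xi)=(\mathscr LD(\xi,\cdot))(z)$.
   Context: Let $p:V\times V\to[0,\infty)$ satisfy $p(x,x)=0$ for all $x$ and irreducibility: for all $x,y\in V$ there exist $x_1=x,\dots,x_m=y$ with $\prod_{l=1}^{m-1}p(x_l,x_{l+1})>0$. $\mathrm{SIP}(\alpha)$ is the process on $\mathbb N^V$ with generator $Lf(\xi)=\sum_{x,y\in V}p(x,y)L_{x,y}f(\xi)$, with single-edge generators $$L_{x,y}f(\xi)=\xi_x(\alpha+\xi_y)(f(\xi^{x,y})-f(\xi))+\xi_y(\alpha+\xi_x)(f(\xi^{y,x})-f(\xi)),$$ where $\xi^{x,y}$ is $\xi$ with one particle moved from $x$ to $y$ (terms with zero rate vanish). $\mathrm{BEP}(\alpha)$ is the process on $\mathbb R_+^V$, $\mathbb R_+=[0,\infty)$, with generator $\mathscr Lf(z)=\sum_{x,y\in V}p(x,y)\mathscr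 L_{x,y}f(z)$, with single-edge generators $$\mathscr L_{x,y}f(z)=\left[-\alpha(z_x-z_y)(\partial_x-\partial_y)+z_xz_y(\partial_x-\partial_y)^2\right]f(z).$$ Duality of the processes with duality function $D$ means: for all $t>0$, $\xi\in\mathbb N^V$, $z\in\mathbb R_+^V$, $\hat{\mathbb E}_\xi D(\xi(t),z)=\mathbb E_zD(\xi,z(t))$. Duality of the single-edge generators means that, for two sites $x\neq y$, $L_{x,y}$ acting on the variables $(\xi_x,\xi_y)$ and $\mathscr L_{x,y}$ acting on $(z_x,z_y)$ give the same result when applied to $d(\xi_x,z_x)\,d(\xi_y,z_y)$. Here ${}_1F_1(-k;\alpha;w)=\sum_{r=0}^k\frac{(-k)_r}{(\alpha)_r}\frac{w^r}{r!}$, with $(c)_r=c(c+1)\cdots(c+r-1)$, $(c)_0=1$. *)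

theory Defs
  imports "HOL-Probability.Probability"
begin

definition irreducible_rates :: "('v \<Rightarrow> 'v \<Rightarrow> real) \<Rightarrow> bool" where
  "irreducible_rates p \<longleftrightarrow>
     (\<forall>x y. \<exists>xs. xs \<noteq> [] \<and> hd xs = x \<and> last xs = y \<and>
        (\<Prod>l<length xs - 1. p (xs ! l) (xs ! Suc l)) > 0)"

text \<open>
  A Markov process is represented by its transition function: \<open>P t s\<close> is the law at time \<open>t\<close>
  of the process started from \<open>s\<close>, so the expectation of \<open>f\<close> at time \<open>t\<close> is the integral of
  \<open>f\<close> against \<open>P t s\<close>.  That \<open>G\<close> is its generator is expressed by the forward equation
  \<open>d/dt P\<^sub>t f = P\<^sub>t (G f)\<close> for all \<open>f\<close> in the class \<open>C\<close> of test functions.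
\<close>
definition markov_process_with_generator ::
    "'s measure \<Rightarrow> ('s \<Rightarrow> real) set \<Rightarrow> (('s \<Rightarrow> real) \<Rightarrow> 's \<Rightarrow> real) \<Rightarrow>
     (real \<Rightarrow> 's \<Rightarrow> 's measure) \<Rightarrow> bool" where
  "markov_process_with_generator S C G P \<longleftrightarrow>
     (\<forall>t\<ge>0. P t \<in> S \<rightarrow>\<^sub>M prob_algebra S) \<and>
     (\<forall>s\<in>space S. P 0 s = return S s) \<and>
     (\<forall>t\<ge>0. \<forall>u\<ge>0. \<forall>s\<in>space S. P (t + u) s = P t s \<bind> P u) \<and>
     (\<forall>f\<in>C. \<forall>s\<in>space S. \<forall>t\<ge>0.
        ((\<lambda>u. \<integral>r. f r \<partial>P u s) has_real_derivative (\<integral>r. G f r \<partial>P t s)) (at t within {0..}))"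


text \<open>For \<open>\<xi> x = 0\<close> the result of \<open>move x y \<xi>\<close> is junk, but it only occurs with rate zero.\<close>
definition move :: "'v \<Rightarrow> 'v \<Rightarrow> ('v \<Rightarrow> nat) \<Rightarrow> ('v \<Rightarrow> nat)" where
  "move x y \<xi> = (let \<eta> = \<xi>(x := \<xi> x - 1) in \<eta>(y := \<eta> y + 1))"

definition sip_edge ::
    "real \<Rightarrow> 'v \<Rightarrow> 'v \<Rightarrow> (('v \<Rightarrow> nat) \<Rightarrow> real) \<Rightarrow> ('v \<Rightarrow> nat) \<Rightarrow> real" where
  "sip_edge \<alpha> x y f \<xi> =
     real (\<xi> x) * (\<alpha> + real (\<xi> y)) * (f (move x y \<xi>) - f \<xi>) +
     real (\<xi> y) * (\<alpha> + real (\<xi> x)) * (f (move y x \<xi>) - f \<xi>)"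

definition sip_generator ::
    "('v::finite \<Rightarrow> 'v \<Rightarrow> real) \<Rightarrow> real \<Rightarrow> (('v \<Rightarrow> nat) \<Rightarrow> real) \<Rightarrow> ('v \<Rightarrow> nat) \<Rightarrow> real" where
  "sip_generator p \<alpha> f \<xi> = (\<Sum>x\<in>UNIV. \<Sum>y\<in>UNIV. p x y * sip_edge \<alpha> x y f \<xi>)"

text \<open>
  The particle number is conserved, so every state can reach only finitely many others, and
  the finitely supported functions are mapped to themselves and determine the process.
\<close>
definition sip_process ::
    "('v::finite \<Rightarrow> 'v \<Rightarrow> real) \<Rightarrow> real \<Rightarrow> (real \<Rightarrow> ('v \<Rightarrow> nat) \<Rightarrow> ('v \<Rightarrow> nat) measure) \<Rightarrow> bool" where
  "sip_process p \<alpha> P \<longleftrightarrow>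
     markov_process_with_generator (count_space UNIV) {f. finite {\<xi>. f \<xi> \<noteq> 0}}
       (sip_generator p \<alpha>) P"


definition orthant :: "('v \<Rightarrow> real) set" where
  "orthant = {z. \<forall>x. 0 \<le> z x}"

text \<open>Functions matter only on the orthant; on its faces the derivatives are one-sided.\<close>
definition partial_deriv :: "'v \<Rightarrow> (('v \<Rightarrow> real) \<Rightarrow> real) \<Rightarrow> ('v \<Rightarrow> real) \<Rightarrow> real" where
  "partial_deriv x f z = vector_derivative (\<lambda>t. f (z(x := t))) (at (z x) within {0..})"

definition twice_partially_differentiable :: "(('v \<Rightarrow> real) \<Rightarrow> real) \<Rightarrow> bool" where
  "twice_partially_differentiable f \<longleftrightarrow>
     (\<forall>z\<in>orthant. \<forall>x y.
        (\<lambda>t. f (z(x := t))) differentiable (at (z x) within {0..}) \<and>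
        (\<lambda>t. partial_deriv x f (z(y := t))) differentiable (at (z y) within {0..}))"

definition deriv_diff :: "'v \<Rightarrow> 'v \<Rightarrow> (('v \<Rightarrow> real) \<Rightarrow> real) \<Rightarrow> ('v \<Rightarrow> real) \<Rightarrow> real" where
  "deriv_diff x y f z = partial_deriv x f z - partial_deriv y f z"

definition bep_edge ::
    "real \<Rightarrow> 'v \<Rightarrow> 'v \<Rightarrow> (('v \<Rightarrow> real) \<Rightarrow> real) \<Rightarrow> ('v \<Rightarrow> real) \<Rightarrow> real" where
  "bep_edge \<alpha> x y f z =
     - \<alpha> * (z x - z y) * deriv_diff x y f z + z x * z y * deriv_diff x y (deriv_diff x y f) z"

definition bep_generator ::
    "('v::finite \<Rightarrow> 'v \<Rightarrow> real) \<Rightarrow> real \<Rightarrow> (('v \<Rightarrow> real) \<Rightarrow> real) \<Rightarrow> ('v \<Rightarrow> real) \<Rightarrow> real" where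
  "bep_generator p \<alpha> f z = (\<Sum>x\<in>UNIV. \<Sum>y\<in>UNIV. p x y * bep_edge \<alpha> x y f z)"

text \<open>
  Functions of bounded support whose partial derivatives up to order two are continuous up to
  the boundary.  They determine the process: the total energy is conserved, so on each compact simplex they
  include all polynomials, and the generator maps polynomials of degree at most \<open>n\<close> to such
  polynomials.
\<close>
definition bep_test_functions :: "(('v::finite \<Rightarrow> real) \<Rightarrow> real) set" where
  "bep_test_functions = {f.
     twice_partially_differentiable f \<and>
     continuous_on orthant f \<and>
     (\<forall>x. continuous_on orthant (partial_deriv x f)) \<and>
     (\<forall>x y. continuous_on orthant (partial_deriv y (partial_deriv x f))) \<and>
     (\<exists>r. \<forall>z\<in>orthant. (\<exists>x. r < z x) \<longrightarrow> f z = 0)}"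

definition bep_process ::
    "('v::finite \<Rightarrow> 'v \<Rightarrow> real) \<Rightarrow> real \<Rightarrow> (real \<Rightarrow> ('v \<Rightarrow> real) \<Rightarrow> ('v \<Rightarrow> real) measure) \<Rightarrow> bool" where
  "bep_process p \<alpha> Q \<longleftrightarrow>
     markov_process_with_generator (restrict_space borel orthant) bep_test_functions
       (bep_generator p \<alpha>) Q"

text \<open>Gamma distribution on \<open>[0,\<infinity>)\<close> with shape \<open>\<alpha>\<close> and rate \<open>l\<close>, i.e. scale \<open>1/l\<close>.\<close>
definition gamma_measure :: "real \<Rightarrow> real \<Rightarrow> real measure" where
  "gamma_measure \<alpha> l =
     density (restrict_space lborel {0..})
       (\<lambda>z. ennreal (z powr (\<alpha> - 1) * exp (- l * z) * (l powr \<alpha> / Gamma \<alpha>)))"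


definition factorized ::
    "(nat \<Rightarrow> real \<Rightarrow> real) \<Rightarrow> ('v::finite \<Rightarrow> nat) \<Rightarrow> ('v \<Rightarrow> real) \<Rightarrow> real" where
  "factorized d \<xi> z = (\<Prod>x\<in>UNIV. d (\<xi> x) (z x))"

definition dual_processes ::
    "(real \<Rightarrow> ('v \<Rightarrow> nat) \<Rightarrow> ('v \<Rightarrow> nat) measure) \<Rightarrow>
     (real \<Rightarrow> ('v \<Rightarrow> real) \<Rightarrow> ('v \<Rightarrow> real) measure) \<Rightarrow>
     (('v \<Rightarrow> nat) \<Rightarrow> ('v \<Rightarrow> real) \<Rightarrow> real) \<Rightarrow> bool" where
  "dual_processes P Q D \<longleftrightarrow>
     (\<forall>t>0. \<forall>\<xi>. \<forall>z\<in>orthant.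
        integrable (P t \<xi>) (\<lambda>\<eta>. D \<eta> z) \<and> integrable (Q t z) (D \<xi>) \<and>
        (\<integral>\<eta>. D \<eta> z \<partial>P t \<xi>) = (\<integral>w. D \<xi> w \<partial>Q t z))"

text \<open>The differentiability clause says that the differential operator \<open>B\<close> can be applied to \<open>D \<xi>\<close>.\<close>
definition dual_generators ::
    "((('v \<Rightarrow> nat) \<Rightarrow> real) \<Rightarrow> ('v \<Rightarrow> nat) \<Rightarrow> real) \<Rightarrow>
     ((('v \<Rightarrow> real) \<Rightarrow> real) \<Rightarrow> ('v \<Rightarrow> real) \<Rightarrow> real) \<Rightarrow>
     (('v \<Rightarrow> nat) \<Rightarrow> ('v \<Rightarrow> real) \<Rightarrow> real) \<Rightarrow> bool" where
  "dual_generators A B D \<longleftrightarrow>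
     (\<forall>\<xi>. twice_partially_differentiable (D \<xi>)) \<and>
     (\<forall>\<xi>. \<forall>z\<in>orthant. A (\<lambda>\<eta>. D \<eta> z) \<xi> = B (D \<xi>) z)"

text \<open>
  A single-edge generator acts only on the variables of its two sites; these are
  represented by the two elements of \<open>bool\<close>.
\<close>
definition dual_edge_generators :: "real \<Rightarrow> (nat \<Rightarrow> real \<Rightarrow> real) \<Rightarrow> bool" where
  "dual_edge_generators \<alpha> d \<longleftrightarrow>
     dual_generators (sip_edge \<alpha> False True) (bep_edge \<alpha> False True)
       (\<lambda>\<xi> z. d (\<xi> False) (z False) * d (\<xi> True) (z True))"


definition has_laplace_transform :: "(real \<Rightarrow> real) \<Rightarrow> (real \<Rightarrow> real) \<Rightarrow> bool" where
  "has_laplace_transform f F \<longleftrightarrow>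
     (\<forall>l>0. set_integrable lborel {0..} (\<lambda>z. f z * exp (- l * z)) \<and>
            (LINT z:{0..}|lborel. f z * exp (- l * z)) = F l)"

text \<open>The confluent hypergeometric function with first parameter \<open>-k\<close>.\<close>
definition hyp1F1_neg :: "nat \<Rightarrow> real \<Rightarrow> real \<Rightarrow> real" where
  "hyp1F1_neg k \<alpha> w =
     (\<Sum>r\<le>k. pochhammer (- real k) r / pochhammer \<alpha> r * (w ^ r / fact r))"

text \<open>
  The classical generalized Laguerre polynomial with parameter \<open>\<beta>\<close>, evaluated at \<open>\<mu> * z\<close>.
\<close>
definition laguerre :: "nat \<Rightarrow> real \<Rightarrow> real \<Rightarrow> real \<Rightarrow> real" where
  "laguerre k \<beta> \<mu> z =
     (\<Sum>i\<le>k. (-1) ^ i * ((real k + \<beta>) gchoose (k - i)) * (\<mu> * z) ^ i / fact i)"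

end

(*
  Write e_k(z) = sum over r of C(k,r) a^(k-r) (b alpha)^r z^r / (alpha)_r, which covers both cases
  a = 0 and a \<noteq> 0.  These polynomials satisfy
    (A)  z e_k' = k (e_k - a e_{k-1}),
    (B)  z e_k'' + alpha e_k' = k b alpha e_{k-1},
    (C)  (alpha + k) e_{k+1} = a (alpha + k) e_k + z (a e_k' + b alpha e_k),
  and the edge duality of the product e_k(u) e_n(v) is an algebraic consequence of (A)-(C).
  Conversely, edge duality at (k, 0) is linear in the second variable v once d(1,v) = a + b v is known
  (take k = 1, u = 0); comparing coefficients of v gives (A) and (B), and differentiating (A)
  gives (C), which determines d(k,.) recursively from d(0,.) = 1.
  The Laplace transform is the binomial theorem applied termwise, and orthogonality of the Laguerre
  polynomials says that k-th differences annihilate polynomials of degree less than k.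
*)
theory Submission
  imports Defs
begin

section \<open>Duality polynomials\<close>

text \<open>The prefactor a^k of the hypergeometric form is distributed over the sum, so no division
  by a occurs. For a = 0 only the term r = k survives, because 0^0 = 1.\<close>

definition duality_poly :: "real \<Rightarrow> real \<Rightarrow> real \<Rightarrow> nat \<Rightarrow> real poly" where
  "duality_poly \<alpha> a b k =
     (\<Sum>r\<le>k. monom (real (k choose r) * a ^ (k - r) * (b * \<alpha>) ^ r / pochhammer \<alpha> r) r)"

lemma coeff_duality_poly:
  "coeff (duality_poly \<alpha> a b k) r = real (k choose r) * a ^ (k - r) * (b * \<alpha>) ^ r / pochhammer \<alpha> r"
  unfolding duality_poly_def by (simp add: coeff_sum coeff_monom sum.delta)

lemma poly_duality_poly:
  "poly (duality_poly \<alpha> a b k) z =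
     (\<Sum>r\<le>k. real (k choose r) * a ^ (k - r) * (b * \<alpha>) ^ r / pochhammer \<alpha> r * z ^ r)"
  unfolding duality_poly_def by (simp add: poly_sum poly_monom)

lemma duality_poly_0 [simp]: "duality_poly \<alpha> a b 0 = 1"
  by (simp add: duality_poly_def monom_0)

text \<open>Guards against truncated subtraction: for r \<ge> k the two powers of a may differ, but
  then the binomial coefficient is zero.\<close>

lemma binomial_times_power_diff:
  "real (k choose Suc r) * (a * a ^ (k - Suc r)) = real (k choose Suc r) * a ^ (k - r)"
  for a :: real
  by (cases "r < k") (simp_all add: Suc_diff_Suc flip: power_Suc)

lemma Suc_times_real_binomial:
  "(1 + real r) * real (k choose Suc r) = (real k - real r) * real (k choose r)"
proof (cases "r \<le> k")
  case True
  have "Suc r * (k choose Suc r) = (k - r) * (k choose r)"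
    by (metis binomial_absorb_comp binomial_absorption)
  then have "real (Suc r * (k choose Suc r)) = real ((k - r) * (k choose r))" by simp
  then show ?thesis using True by (simp add: of_nat_diff algebra_simps)
qed (simp add: binomial_eq_0)

text \<open>Relation (A) of the overview, with \<open>pCons 0\<close> as multiplication by z. On
  coefficients it is r C(k,r) = k (C(k,r) - C(k-1,r)), that is, Pascal's rule and absorption. At k =
  0 the truncated index \<open>k - 1\<close> is harmless because of the factor
  \<open>real k\<close>.\<close>

lemma pCons_pderiv_duality_poly:
  "pCons 0 (pderiv (duality_poly \<alpha> a b k)) =
     smult (real k) (duality_poly \<alpha> a b k - smult a (duality_poly \<alpha> a b (k - 1)))"
proof (cases k)
  case (Suc m)
  show ?thesis
  proof (rule poly_eqI)
    fix n
    show "coeff (pCons 0 (pderiv (duality_poly \<alpha> a b k))) n =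
      coeff (smult (real k) (duality_poly \<alpha> a b k - smult a (duality_poly \<alpha> a b (k - 1)))) n"
    proof (cases n)
      case (Suc r)
      have "(1 + real r) * real (Suc m choose Suc r) = (1 + real m) * real (m choose r)"
        using Suc_times_binomial_eq[of m r] by (metis of_nat_Suc of_nat_mult mult.commute)
      then have "(1 + real r) * (real (m choose r) + real (m choose Suc r)) = (1 + real m) * real (m choose r)"
        by simp
      then have "(1 + real r) * ((real (m choose r) + real (m choose Suc r)) * a ^ (m - r)) =
        (1 + real m) * ((real (m choose r) + real (m choose Suc r)) * a ^ (m - r) -
          real (m choose Suc r) * a ^ (m - r))"
        by (metis add_diff_cancel_right' left_diff_distrib mult.assoc)
      then have "(1 + real r) * ((real (m choose r) + real (m choose Suc r)) * a ^ (m - r)) =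
        (1 + real m) * ((real (m choose r) + real (m choose Suc r)) * a ^ (m - r) -
          real (m choose Suc r) * (a * a ^ (m - Suc r)))"
        unfolding binomial_times_power_diff .
      \<comment> \<open>This is the factor shared by all the coefficients at index
        \<open>Suc r\<close>. Multiplying by it, instead of cancelling it, stays valid even where
        the Pochhammer symbol vanishes.\<close>
      from arg_cong[OF this, of "\<lambda>x. x * ((b * \<alpha>) ^ Suc r / pochhammer \<alpha> (Suc r))"]
      show ?thesis using \<open>k = Suc m\<close> Suc
        by (simp add: coeff_pderiv coeff_duality_poly algebra_simps diff_divide_distrib add_divide_distrib del: power_Suc pochhammer_Suc)
    qed (use \<open>k = Suc m\<close> in \<open>simp add: coeff_duality_poly\<close>)
  qed
qed simp

text \<open>Relation (B). The left side multiplies the coefficient of index n+1 by (n+1)(alpha+n):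
  the factor alpha+n cancels the last factor of (alpha)_(n+1), and n+1 is absorbed by the binomial
  coefficient.\<close>

lemma second_pderiv_duality_poly:
  assumes "\<alpha> > 0"
  shows "pCons 0 (pderiv (pderiv (duality_poly \<alpha> a b k))) + smult \<alpha> (pderiv (duality_poly \<alpha> a b k)) =
    smult (real k * (b * \<alpha>)) (duality_poly \<alpha> a b (k - 1))"
proof (cases k)
  case (Suc m)
  show ?thesis
  proof (rule poly_eqI)
    fix n
    have "pochhammer \<alpha> n > 0" "\<alpha> + real n > 0"
      using assms by (auto simp: pochhammer_pos)
    then have "(1 + real n) * (\<alpha> + real n) * (real (Suc m choose Suc n) * a ^ (m - n) *
        (b * \<alpha>) ^ Suc n / (pochhammer \<alpha> n * (\<alpha> + real n))) =
        ((1 + real n) * real (Suc m choose Suc n)) * (a ^ (m - n) * (b * \<alpha>) ^ Suc n / pochhammer \<alpha> n)"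
      by (simp del: binomial_Suc_Suc)
    also have "(1 + real n) * real (Suc m choose Suc n) = (1 + real m) * real (m choose n)"
      using Suc_times_binomial_eq[of m n] by (metis of_nat_Suc of_nat_mult mult.commute)
    finally have "(1 + real n) * (\<alpha> + real n) * (real (Suc m choose Suc n) * a ^ (m - n) *
        (b * \<alpha>) ^ Suc n / (pochhammer \<alpha> n * (\<alpha> + real n))) =
        (1 + real m) * (b * \<alpha>) * (real (m choose n) * a ^ (m - n) * (b * \<alpha>) ^ n / pochhammer \<alpha> n)"
      by simp
    moreover have "coeff (pCons 0 (pderiv (pderiv (duality_poly \<alpha> a b k))) +
        smult \<alpha> (pderiv (duality_poly \<alpha> a b k))) n =
        (1 + real n) * (\<alpha> + real n) * coeff (duality_poly \<alpha> a b k) (Suc n)"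
      by (cases n) (simp_all add: coeff_pderiv algebra_simps)
    ultimately show "coeff (pCons 0 (pderiv (pderiv (duality_poly \<alpha> a b k))) +
        smult \<alpha> (pderiv (duality_poly \<alpha> a b k))) n =
      coeff (smult (real k * (b * \<alpha>)) (duality_poly \<alpha> a b (k - 1))) n"
      using \<open>k = Suc m\<close>
      by (simp add: coeff_duality_poly pochhammer_Suc del: binomial_Suc_Suc power_Suc)
  qed
qed simp

text \<open>Relation (C). On coefficients it reduces to (alpha+k) C(k+1,r+1) = (alpha+k+1+r)
  C(k,r+1) + (alpha+r) C(k,r), which follows from Pascal's rule and (1+r) C(k,r+1) = (k-r)
  C(k,r).\<close>

lemma duality_poly_Suc:
  assumes "\<alpha> > 0"
  shows "smult (\<alpha> + real k) (duality_poly \<alpha> a b (Suc k)) =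
    smult (a * (\<alpha> + real k)) (duality_poly \<alpha> a b k) +
    pCons 0 (smult a (pderiv (duality_poly \<alpha> a b k)) + smult (b * \<alpha>) (duality_poly \<alpha> a b k))"
proof (rule poly_eqI)
  fix n
  show "coeff (smult (\<alpha> + real k) (duality_poly \<alpha> a b (Suc k))) n =
    coeff (smult (a * (\<alpha> + real k)) (duality_poly \<alpha> a b k) +
      pCons 0 (smult a (pderiv (duality_poly \<alpha> a b k)) + smult (b * \<alpha>) (duality_poly \<alpha> a b k))) n"
  proof (cases n)
    case (Suc r)
    have pos: "pochhammer \<alpha> r > 0" "\<alpha> + real r > 0"
      using assms by (auto simp: pochhammer_pos)
    have "(\<alpha> + real k) * real (Suc k choose Suc r) =
      (\<alpha> + real k) * real (k choose Suc r) + (1 + real r) * real (k choose Suc r) +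
      (\<alpha> + real r) * real (k choose r)"
      unfolding Suc_times_real_binomial by (simp add: algebra_simps)
    then have "(\<alpha> + real k) * (real (Suc k choose Suc r) * a ^ (k - r)) =
      (\<alpha> + real k) * (real (k choose Suc r) * (a * a ^ (k - Suc r))) +
      (1 + real r) * (real (k choose Suc r) * (a * a ^ (k - Suc r))) +
      (\<alpha> + real r) * (real (k choose r) * a ^ (k - r))"
      unfolding binomial_times_power_diff
      by (simp add: distrib_right mult.assoc del: binomial_Suc_Suc flip: mult.assoc)
    \<comment> \<open>\<open>K\<close> later becomes (b alpha)^(r+1) / (alpha)_(r+1). It stays a
      variable here so that distributivity leaves it intact.\<close>
    then have "(\<alpha> + real k) * (real (Suc k choose Suc r) * a ^ (k - r)) * K =
      ((\<alpha> + real k) * (real (k choose Suc r) * (a * a ^ (k - Suc r))) +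
      (1 + real r) * (real (k choose Suc r) * (a * a ^ (k - Suc r))) +
      (\<alpha> + real r) * (real (k choose r) * a ^ (k - r))) * K" for K
      by (rule arg_cong)
    then have "(\<alpha> + real k) * (real (Suc k choose Suc r) * a ^ (k - r)) * K =
      (\<alpha> + real k) * (real (k choose Suc r) * (a * a ^ (k - Suc r))) * K +
      (1 + real r) * (real (k choose Suc r) * (a * a ^ (k - Suc r))) * K +
      (real (k choose r) * a ^ (k - r)) * ((\<alpha> + real r) * K)" for K
      by (simp only: distrib_right distrib_left mult_1_left ac_simps)
    note this[of "(b * \<alpha>) ^ Suc r / pochhammer \<alpha> (Suc r)"]
    also have "C * ((\<alpha> + real r) * ((b * \<alpha>) ^ Suc r / pochhammer \<alpha> (Suc r))) =
      b * \<alpha> * (C * (b * \<alpha>) ^ r / pochhammer \<alpha> r)" for C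
      using pos by (simp add: pochhammer_Suc)
    finally show ?thesis using Suc
      by (simp add: coeff_pderiv coeff_duality_poly mult_ac
          del: binomial_Suc_Suc power_Suc)
  qed (simp add: coeff_duality_poly)
qed

section \<open>Closed forms: hypergeometric, monomial and Laguerre\<close>

text \<open>Since (-k)_r = (-1)^r r! C(k,r), the sign cancels against that of the argument, and a^k
  / a^r = a^(k-r).\<close>

lemma poly_duality_poly_eq_hyp1F1_neg:
  assumes "a \<noteq> 0"
  shows "poly (duality_poly \<alpha> a b k) z = a ^ k * hyp1F1_neg k \<alpha> (- (b * \<alpha> / a) * z)"
  unfolding poly_duality_poly hyp1F1_neg_def sum_distrib_left
proof (rule sum.cong)
  fix r assume "r \<in> {..k}"
  then have "r \<le> k" by simp
  have "pochhammer (- real k) r = (-1) ^ r * fact r * real (k choose r)"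
    by (simp add: binomial_gbinomial gbinomial_pochhammer flip: power_mult_distrib mult.assoc)
  moreover have "a ^ k = a ^ (k - r) * a ^ r"
    using \<open>r \<le> k\<close> by (simp flip: power_add)
  moreover have "(- (b * \<alpha> / a) * z) ^ r = (-1) ^ r * (b * \<alpha>) ^ r / a ^ r * z ^ r"
    by (simp add: power_minus[of "b * \<alpha> * z / a"] power_mult_distrib power_divide)
  ultimately show "real (k choose r) * a ^ (k - r) * (b * \<alpha>) ^ r / pochhammer \<alpha> r * z ^ r =
    a ^ k * (pochhammer (- real k) r / pochhammer \<alpha> r * ((- (b * \<alpha> / a) * z) ^ r / fact r))"
    using assms by (simp add: flip: power_mult_distrib mult.assoc)
qed simp

lemma poly_duality_poly_zero:
  assumes "\<alpha> > 0"
  shows "poly (duality_poly \<alpha> 0 b k) z = (b * \<alpha>) ^ k * (z ^ k * Gamma \<alpha> / Gamma (\<alpha> + real k))"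
proof -
  have "\<alpha> \<notin> \<int>\<^sub>\<le>\<^sub>0" using assms by (auto elim!: nonpos_Ints_cases)
  then have "pochhammer \<alpha> k = Gamma (\<alpha> + real k) / Gamma \<alpha>" by (rule pochhammer_Gamma)
  moreover have "poly (duality_poly \<alpha> 0 b k) z = (\<Sum>r\<le>k. if r = k then (b * \<alpha>) ^ k / pochhammer \<alpha> k * z ^ k else 0)"
    unfolding poly_duality_poly by (intro sum.cong) (auto simp: power_0_left)
  ultimately show ?thesis by simp
qed

text \<open>The generalized binomial coefficient is (alpha+r)_(k-r) / (k-r)!, and (alpha)_k =
  (alpha)_r (alpha+r)_(k-r) turns it into a denominator (alpha)_r. This form serves both the
  comparison with \<open>hyp1F1_neg\<close> and the orthogonality.\<close>

lemma laguerre_eq: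
  assumes "\<alpha> > 0"
  shows "laguerre k (\<alpha> - 1) \<mu> z =
    pochhammer \<alpha> k / fact k * (\<Sum>r\<le>k. (-1) ^ r * real (k choose r) / pochhammer \<alpha> r * (\<mu> * z) ^ r)"
  unfolding laguerre_def sum_distrib_left
proof (rule sum.cong)
  fix r assume "r \<in> {..k}"
  then have "r \<le> k" by simp
  have "(real k + (\<alpha> - 1)) gchoose (k - r) = pochhammer (\<alpha> + real r) (k - r) / fact (k - r)"
    unfolding gbinomial_pochhammer' using \<open>r \<le> k\<close> by (simp add: of_nat_diff algebra_simps)
  moreover have "pochhammer \<alpha> k = pochhammer \<alpha> r * pochhammer (\<alpha> + real r) (k - r)"
    using \<open>r \<le> k\<close> by (rule pochhammer_product)
  moreover have "pochhammer \<alpha> r > 0" using assms by (rule pochhammer_pos)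
  ultimately show "(-1) ^ r * (real k + (\<alpha> - 1) gchoose (k - r)) * (\<mu> * z) ^ r / fact r =
    pochhammer \<alpha> k / fact k * ((-1) ^ r * real (k choose r) / pochhammer \<alpha> r * (\<mu> * z) ^ r)"
    using \<open>r \<le> k\<close> by (simp add: binomial_fact field_simps)
qed simp

lemma laguerre_eq_hyp1F1_neg:
  assumes "\<alpha> > 0"
  shows "fact k * Gamma \<alpha> / Gamma (\<alpha> + real k) * laguerre k (\<alpha> - 1) \<mu> z = hyp1F1_neg k \<alpha> (\<mu> * z)"
proof -
  have "\<alpha> \<notin> \<int>\<^sub>\<le>\<^sub>0" using assms by (auto elim!: nonpos_Ints_cases)
  then have "pochhammer \<alpha> k = Gamma (\<alpha> + real k) / Gamma \<alpha>" by (rule pochhammer_Gamma)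
  moreover have "Gamma \<alpha> > 0" "Gamma (\<alpha> + real k) > 0" using assms by (auto intro!: Gamma_real_pos)
  ultimately have "fact k * Gamma \<alpha> / Gamma (\<alpha> + real k) * laguerre k (\<alpha> - 1) \<mu> z =
    (\<Sum>r\<le>k. (-1) ^ r * real (k choose r) / pochhammer \<alpha> r * (\<mu> * z) ^ r)"
    unfolding laguerre_eq[OF assms] by simp
  moreover have "pochhammer (- real k) r = (-1) ^ r * fact r * real (k choose r)" for r
    by (simp add: binomial_gbinomial gbinomial_pochhammer flip: power_mult_distrib mult.assoc)
  ultimately show ?thesis
    unfolding hyp1F1_neg_def by (simp add: mult.assoc)
qed

text \<open>A k-th finite difference of a polynomial of degree i < k in r. The induction peels off
  one difference, which lowers the degree by one and shifts the base point, so both \<open>x\<close>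
  and \<open>i\<close> must be general.\<close>

lemma alternating_sum_pochhammer_eq_0:
  fixes x :: real
  assumes "i < k"
  shows "(\<Sum>r\<le>k. (-1) ^ r * real (k choose r) * pochhammer (x + real r) i) = 0"
  using assms
proof (induction k arbitrary: x i)
  case (Suc k)
  define S where "S k x i = (\<Sum>r\<le>k. (-1) ^ r * real (k choose r) * pochhammer (x + real r) i)"
    for k i and x :: real
  have "S (Suc k) x i = pochhammer x i +
      (\<Sum>r\<le>k. (-1) ^ Suc r * real (k choose Suc r) * pochhammer (x + real (Suc r)) i) +
      (\<Sum>r\<le>k. (-1) ^ Suc r * real (k choose r) * pochhammer (x + real (Suc r)) i)"
    unfolding S_def by (subst sum.atMost_Suc_shift) (simp add: algebra_simps flip: sum.distrib)
  \<comment> \<open>The term r = 0 and the shifted sum reassemble into a sum up to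
    \<open>Suc k\<close>, whose top term has a vanishing binomial coefficient.\<close>
  also have "pochhammer x i +
      (\<Sum>r\<le>k. (-1) ^ Suc r * real (k choose Suc r) * pochhammer (x + real (Suc r)) i) =
      (\<Sum>r\<le>Suc k. (-1) ^ r * real (k choose r) * pochhammer (x + real r) i)"
    by (subst sum.atMost_Suc_shift) simp
  also have "\<dots> = S k x i" by (simp add: S_def)
  also have "(\<Sum>r\<le>k. (-1) ^ Suc r * real (k choose r) * pochhammer (x + real (Suc r)) i) = - S k (x + 1) i"
    unfolding S_def sum_negf[symmetric] by (intro sum.cong) (simp_all add: algebra_simps)
  finally have rec: "S (Suc k) x i = S k x i - S k (x + 1) i" by simp
  show ?case
  proof (cases i)
    case 0
    then show ?thesis using rec unfolding S_def by simp
  next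
    case (Suc j)
    \<comment> \<open>One difference of a rising factorial: both terms share the factor
      \<open>pochhammer (1 + y) j\<close>, and the remaining factors y and 1 + y + j differ by i = j
      + 1.\<close>
    have "pochhammer y i - pochhammer (1 + y) i = - real i * pochhammer (1 + y) j" for y :: real
      unfolding Suc pochhammer_rec[of y] pochhammer_Suc[of "1 + y"] by (simp add: algebra_simps)
    from this[of "x + real r" for r]
    have "pochhammer (x + real r) i - pochhammer (x + 1 + real r) i =
        - real i * pochhammer (x + 1 + real r) j" for r
      by (metis add.assoc add.commute)
    then have "S k x i - S k (x + 1) i = - real i * S k (x + 1) j"
      unfolding S_def sum_distrib_left sum_subtractf[symmetric]
      by (intro sum.cong refl) (simp flip: right_diff_distrib)
    also have "S k (x + 1) j = 0"
      unfolding S_def using Suc.IH[of j "x + 1"] Suc.prems Suc by simp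
    finally show ?thesis using rec unfolding S_def by simp
  qed
qed simp

section \<open>Gamma integrals\<close>

text \<open>Euler's integral for \<open>Gamma s\<close> under the substitution t = l z; the constant
  1 / l^(s-1) undoes the scaling inside the power.\<close>

lemma has_bochner_integral_Gamma:
  fixes s l :: real
  assumes "s > 0" "l > 0"
  shows "has_bochner_integral lborel (\<lambda>z. indicator {0..} z * (z powr (s - 1) * exp (- l * z)))
    (Gamma s / l powr s)"
proof -
  have "has_bochner_integral lborel (\<lambda>t. indicator {0..} t * t powr (s - 1) / exp t) (Gamma s)"
    using assms Gamma_conv_nn_integral_real[of s]
    by (intro has_bochner_integral_nn_integral) (auto intro!: less_imp_le[OF Gamma_real_pos])
  then have "has_bochner_integral lborel
      (\<lambda>z. indicator {0..} (0 + l * z) * (0 + l * z) powr (s - 1) / exp (0 + l * z)) (Gamma s /\<^sub>R \<bar>l\<bar>)"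
    using assms by (subst (asm) lborel_has_bochner_integral_real_affine_iff[where c = l and t = 0]) auto
  then have "has_bochner_integral lborel
      (\<lambda>z. (1 / l powr (s - 1)) *
         (indicator {0..} (0 + l * z) * (0 + l * z) powr (s - 1) / exp (0 + l * z)))
      ((1 / l powr (s - 1)) * (Gamma s /\<^sub>R \<bar>l\<bar>))"
    by (rule has_bochner_integral_mult_right)
  moreover have "(1 / l powr (s - 1)) *
      (indicator {0..} (0 + l * z) * (0 + l * z) powr (s - 1) / exp (0 + l * z)) =
      indicator {0..} z * (z powr (s - 1) * exp (- l * z))" for z
    using assms by (auto simp: indicator_def powr_mult exp_minus field_simps zero_le_mult_iff)
  moreover have "(1 / l powr (s - 1)) * (Gamma s /\<^sub>R \<bar>l\<bar>) = Gamma s / l powr s"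
    using assms by (simp add: powr_diff field_simps)
  ultimately show ?thesis by simp
qed

lemma has_bochner_integral_power_times_powr:
  assumes "\<alpha> > 0" "l > 0"
  shows "has_bochner_integral lborel
    (\<lambda>z. indicator {0..} z * (z ^ r * (z powr (\<alpha> - 1) / Gamma \<alpha>) * exp (- l * z)))
    (pochhammer \<alpha> r * l powr (- \<alpha> - real r))"
proof -
  have "\<alpha> \<notin> \<int>\<^sub>\<le>\<^sub>0" using assms by (auto elim!: nonpos_Ints_cases)
  then have "pochhammer \<alpha> r = Gamma (\<alpha> + real r) / Gamma \<alpha>" by (rule pochhammer_Gamma)
  moreover have "l powr (- \<alpha> - real r) = 1 / l powr (\<alpha> + real r)"
    using powr_minus_divide[of l "\<alpha> + real r"] by (simp add: algebra_simps)
  ultimately have 1: "(1 / Gamma \<alpha>) * (Gamma (\<alpha> + real r) / l powr (\<alpha> + real r)) =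
    pochhammer \<alpha> r * l powr (- \<alpha> - real r)" by simp
  \<comment> \<open>At z = 0 both sides are 0, since \<open>0 powr x = 0\<close> for every exponent,
    negative ones included.\<close>
  have "z powr (\<alpha> + real r - 1) = z ^ r * z powr (\<alpha> - 1)" if "z \<ge> 0" for z
  proof (cases "z = 0")
    case False
    then have "z > 0" using that by simp
    then show ?thesis by (simp add: powr_realpow[symmetric] powr_add[symmetric] algebra_simps)
  qed simp
  then have 2: "(1 / Gamma \<alpha>) * (indicator {0..} z * (z powr (\<alpha> + real r - 1) * exp (- l * z))) =
      indicator {0..} z * (z ^ r * (z powr (\<alpha> - 1) / Gamma \<alpha>) * exp (- l * z))" for z
    by (simp add: indicator_def)
  have "has_bochner_integral lborel
      (\<lambda>z. (1 / Gamma \<alpha>) * (indicator {0..} z * (z powr (\<alpha> + real r - 1) * exp (- l * z))))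
      ((1 / Gamma \<alpha>) * (Gamma (\<alpha> + real r) / l powr (\<alpha> + real r)))"
    using assms by (intro has_bochner_integral_mult_right has_bochner_integral_Gamma) auto
  then show ?thesis unfolding 1 2 .
qed

lemma gamma_measure_moment:
  assumes "\<alpha> > 0" "l > 0"
  shows "has_bochner_integral (gamma_measure \<alpha> l) (\<lambda>z::real. z ^ r) (pochhammer \<alpha> r / l ^ r)"
  unfolding gamma_measure_def
proof (rule has_bochner_integral_density)
  show "(\<lambda>z::real. z ^ r) \<in> borel_measurable (restrict_space lborel {0..})"
    by (rule measurable_restrict_space1) measurable
  show "(\<lambda>z. z powr (\<alpha> - 1) * exp (- l * z) * (l powr \<alpha> / Gamma \<alpha>))
      \<in> borel_measurable (restrict_space lborel {0..})"
    by (rule measurable_restrict_space1) measurable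
  show "AE z in restrict_space lborel {0..}. 0 \<le> z powr (\<alpha> - 1) * exp (- l * z) * (l powr \<alpha> / Gamma \<alpha>)"
    using assms by (auto intro!: AE_I2 mult_nonneg_nonneg divide_nonneg_pos Gamma_real_pos)
  have "has_bochner_integral lborel
    (\<lambda>z. l powr \<alpha> * (indicator {0..} z * (z ^ r * (z powr (\<alpha> - 1) / Gamma \<alpha>) * exp (- l * z))))
    (l powr \<alpha> * (pochhammer \<alpha> r * l powr (- \<alpha> - real r)))"
    using assms by (intro has_bochner_integral_mult_right has_bochner_integral_power_times_powr)
  moreover have "l powr \<alpha> * (pochhammer \<alpha> r * l powr (- \<alpha> - real r)) = pochhammer \<alpha> r / l ^ r"
  proof -
    have "l powr \<alpha> * l powr (- \<alpha> - real r) = 1 / l ^ r"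
      using assms by (simp add: powr_add[symmetric] powr_minus_divide powr_realpow)
    then show ?thesis by (metis mult.left_commute mult.right_neutral times_divide_eq_right)
  qed
  ultimately show "has_bochner_integral (restrict_space lborel {0..})
    (\<lambda>z. (z powr (\<alpha> - 1) * exp (- l * z) * (l powr \<alpha> / Gamma \<alpha>)) *\<^sub>R z ^ r) (pochhammer \<alpha> r / l ^ r)"
    by (subst has_bochner_integral_restrict_space) (auto simp: mult_ac)
qed

text \<open>The r-th moment contributes (alpha)_r, which cancels the denominator of the r-th
  coefficient. What remains is the binomial expansion of (a l + b alpha)^k.\<close>

lemma laplace_transform_duality_poly:
  assumes "\<alpha> > 0" and d: "\<And>z. z \<ge> 0 \<Longrightarrow> d z = poly (duality_poly \<alpha> a b k) z"
  shows "has_laplace_transform (\<lambda>z. d z * (z powr (\<alpha> - 1) / Gamma \<alpha>))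
    (\<lambda>l. (a * l + b * \<alpha>) ^ k * l powr (- \<alpha> - real k))"
  unfolding has_laplace_transform_def
proof (intro allI impI)
  fix l :: real assume l: "l > 0"
  define c where "c r = real (k choose r) * a ^ (k - r) * (b * \<alpha>) ^ r / pochhammer \<alpha> r" for r
  have d': "d z = (\<Sum>r\<le>k. c r * z ^ r)" if "z \<ge> 0" for z
    using d[OF that] by (simp add: poly_duality_poly c_def)
  have "has_bochner_integral lborel
    (\<lambda>z. \<Sum>r\<le>k. c r * (indicator {0..} z * (z ^ r * (z powr (\<alpha> - 1) / Gamma \<alpha>) * exp (- l * z))))
    (\<Sum>r\<le>k. c r * (pochhammer \<alpha> r * l powr (- \<alpha> - real r)))"
    using assms(1) l
    by (intro has_bochner_integral_sum has_bochner_integral_mult_right has_bochner_integral_power_times_powr)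
  moreover have "(\<Sum>r\<le>k. c r * (indicator {0..} z * (z ^ r * (z powr (\<alpha> - 1) / Gamma \<alpha>) * exp (- l * z)))) =
    indicator {0..} z *\<^sub>R (d z * (z powr (\<alpha> - 1) / Gamma \<alpha>) * exp (- l * z))" for z
    by (simp add: indicator_def d' sum_distrib_right sum_divide_distrib mult.assoc)
  moreover have "(\<Sum>r\<le>k. c r * (pochhammer \<alpha> r * l powr (- \<alpha> - real r))) =
    (a * l + b * \<alpha>) ^ k * l powr (- \<alpha> - real k)"
    \<comment> \<open>The summands are swapped so that the expansion index r becomes the exponent of
      b alpha, as in \<open>duality_poly\<close>.\<close>
    unfolding add.commute[of "a * l"] binomial_ring sum_distrib_right
  proof (rule sum.cong)
    fix r assume "r \<in> {..k}"
    then have "r \<le> k" by simp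
    have "pochhammer \<alpha> r > 0" using assms(1) by (rule pochhammer_pos)
    moreover have "l ^ (k - r) * l powr (- \<alpha> - real k) = l powr (- \<alpha> - real r)"
      using l \<open>r \<le> k\<close> by (simp add: powr_realpow[symmetric] powr_add[symmetric] of_nat_diff add.commute)
    then have "real (k choose r) * (b * \<alpha>) ^ r * (a * l) ^ (k - r) * l powr (- \<alpha> - real k) =
       real (k choose r) * (b * \<alpha>) ^ r * a ^ (k - r) * l powr (- \<alpha> - real r)"
      unfolding power_mult_distrib[of a l] by (simp add: mult.assoc)
    ultimately show "c r * (pochhammer \<alpha> r * l powr (- \<alpha> - real r)) =
      real (k choose r) * (b * \<alpha>) ^ r * (a * l) ^ (k - r) * l powr (- \<alpha> - real k)"
      by (auto simp: c_def)
  qed simp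
  ultimately have "has_bochner_integral lborel
    (\<lambda>z. indicator {0..} z *\<^sub>R (d z * (z powr (\<alpha> - 1) / Gamma \<alpha>) * exp (- l * z)))
    ((a * l + b * \<alpha>) ^ k * l powr (- \<alpha> - real k))"
    by simp
  then show "set_integrable lborel {0..} (\<lambda>z. d z * (z powr (\<alpha> - 1) / Gamma \<alpha>) * exp (- l * z)) \<and>
    (LINT z:{0..}|lborel. d z * (z powr (\<alpha> - 1) / Gamma \<alpha>) * exp (- l * z)) =
      (a * l + b * \<alpha>) ^ k * l powr (- \<alpha> - real k)"
    unfolding set_integrable_def set_lebesgue_integral_def has_bochner_integral_iff .
qed

section \<open>Orthogonality of the Laguerre polynomials\<close>

text \<open>In the r-th term the moment (alpha)_(r+i) divided by (alpha)_r is (alpha+r)_i, and the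
  powers of \<open>\<mu>\<close> cancel up to a common factor. The sum is thus a k-th difference of
  a polynomial in r of degree i < k.\<close>

lemma laguerre_orthogonal_power:
  assumes "\<alpha> > 0" "\<mu> > 0" "i < k"
  shows "has_bochner_integral (gamma_measure \<alpha> \<mu>) (\<lambda>z. z ^ i * laguerre k (\<alpha> - 1) \<mu> z) 0"
proof -
  define c where "c r = pochhammer \<alpha> k / fact k * ((-1) ^ r * real (k choose r) / pochhammer \<alpha> r * \<mu> ^ r)" for r
  have "has_bochner_integral (gamma_measure \<alpha> \<mu>) (\<lambda>z. \<Sum>r\<le>k. c r * z ^ (r + i))
    (\<Sum>r\<le>k. c r * (pochhammer \<alpha> (r + i) / \<mu> ^ (r + i)))"
    using assms by (intro has_bochner_integral_sum has_bochner_integral_mult_right gamma_measure_moment)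
  moreover have "(\<Sum>r\<le>k. c r * z ^ (r + i)) = z ^ i * laguerre k (\<alpha> - 1) \<mu> z" for z
    unfolding laguerre_eq[OF assms(1)] sum_distrib_left c_def power_add power_mult_distrib
    by (intro sum.cong) auto
  moreover have "(\<Sum>r\<le>k. c r * (pochhammer \<alpha> (r + i) / \<mu> ^ (r + i))) = 0"
  proof -
    have "c r * (pochhammer \<alpha> (r + i) / \<mu> ^ (r + i)) =
      pochhammer \<alpha> k / (fact k * \<mu> ^ i) * ((-1) ^ r * real (k choose r) * pochhammer (\<alpha> + real r) i)" for r
      using pochhammer_pos[OF assms(1), of r] assms(2)
      by (simp add: c_def pochhammer_product' power_add)
    then show ?thesis
      using alternating_sum_pochhammer_eq_0[OF assms(3), of \<alpha>]
      by (simp only: sum_distrib_left[symmetric] mult_zero_right)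
  qed
  ultimately show ?thesis by simp
qed

lemma laguerre_orthogonal:
  assumes "\<alpha> > 0" "\<mu> > 0" "j \<noteq> k"
  shows "has_bochner_integral (gamma_measure \<alpha> \<mu>)
    (\<lambda>z. laguerre j (\<alpha> - 1) \<mu> z * laguerre k (\<alpha> - 1) \<mu> z) 0"
proof -
  have *: "has_bochner_integral (gamma_measure \<alpha> \<mu>)
    (\<lambda>z. laguerre j (\<alpha> - 1) \<mu> z * laguerre k (\<alpha> - 1) \<mu> z) 0" if "j < k" for j k
  proof -
    define c where "c i = (-1) ^ i * ((real j + (\<alpha> - 1)) gchoose (j - i)) * \<mu> ^ i / fact i" for i
    have "has_bochner_integral (gamma_measure \<alpha> \<mu>)
      (\<lambda>z. \<Sum>i\<le>j. c i * (z ^ i * laguerre k (\<alpha> - 1) \<mu> z)) (\<Sum>i\<le>j. c i * 0)"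
      using assms that
      by (intro has_bochner_integral_sum has_bochner_integral_mult_right laguerre_orthogonal_power) auto
    moreover have "(\<Sum>i\<le>j. c i * (z ^ i * laguerre k (\<alpha> - 1) \<mu> z)) =
      laguerre j (\<alpha> - 1) \<mu> z * laguerre k (\<alpha> - 1) \<mu> z" for z
      unfolding laguerre_def[of j] sum_distrib_right c_def power_mult_distrib
      by (intro sum.cong) auto
    ultimately show ?thesis by simp
  qed
  show ?thesis
  proof (cases "j < k")
    case False
    then show ?thesis using *[of k j] assms(3) by (simp add: mult.commute)
  qed (rule *)
qed

section \<open>Products of one-variable functions on the orthant\<close>

lemma has_real_derivative_halfline_cong:
  assumes "(f has_real_derivative D) (at t within {0..})" "t \<ge> 0" "\<And>s. s \<ge> 0 \<Longrightarrow> g s = f s"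
  shows "(g has_real_derivative D) (at t within {0..})"
  using has_field_derivative_transform_within[OF assms(1) zero_less_one, of g] assms(2,3) by simp

text \<open>The boundary point t = 0 is included: it is a limit of the half-line from the right, so
  one-sided derivatives are unique there.\<close>

lemma at_within_halfline_neq_bot:
  fixes t :: real
  assumes "t \<ge> 0"
  shows "at t within {0..} \<noteq> bot"
proof -
  have "t islimpt {t..t + 1}" by (simp add: islimpt_Icc)
  then have "t islimpt {0..}" by (rule islimpt_subset) (use assms in auto)
  then show ?thesis by (simp add: trivial_limit_within)
qed

lemma has_real_derivative_halfline_unique:
  assumes "(f has_real_derivative D) (at t within {0..})" "(f has_real_derivative E) (at t within {0..})"
    and "t \<ge> 0"
  shows "D = E"
  using vector_derivative_unique_within[OF at_within_halfline_neq_bot[OF assms(3)]] assms(1,2)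
  by (simp add: has_real_derivative_iff_has_vector_derivative)

lemma vector_derivative_halfline:
  assumes "(f has_real_derivative D) (at t within {0..})" "t \<ge> 0"
  shows "vector_derivative f (at t within {0..}) = D"
  using vector_derivative_within[OF at_within_halfline_neq_bot[OF assms(2)]] assms(1)
  by (simp add: has_real_derivative_iff_has_vector_derivative)

lemma partial_derivI:
  assumes "((\<lambda>t. f (z(x := t))) has_real_derivative D) (at (z x) within {0..})" "z \<in> orthant"
  shows "partial_deriv x f z = D"
  using vector_derivative_halfline[OF assms(1)] assms(2) by (simp add: partial_deriv_def orthant_def)

lemma orthant_update [simp]: "z \<in> orthant \<Longrightarrow> t \<ge> 0 \<Longrightarrow> z(x := t) \<in> orthant"
  by (simp add: orthant_def)

text \<open>Along coordinate x all other factors are constant. Writing the derivative as a product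
  with an updated family keeps the product form, so the rule can be iterated. \<open>f\<close> has
  to agree with the product on the orthant only.\<close>

lemma has_derivative_product_form:
  fixes f :: "('v::finite \<Rightarrow> real) \<Rightarrow> real" and g :: "'v \<Rightarrow> real \<Rightarrow> real"
  assumes f: "\<And>w. w \<in> orthant \<Longrightarrow> f w = (\<Prod>v\<in>UNIV. g v (w v))"
    and g: "\<And>t. t \<ge> 0 \<Longrightarrow> (g x has_real_derivative g' t) (at t within {0..})"
    and z: "z \<in> orthant"
  shows "((\<lambda>t. f (z(x := t))) has_real_derivative (\<Prod>v\<in>UNIV. (g(x := g')) v (z v)))
    (at (z x) within {0..})"
proof -
  define C where "C = (\<Prod>v\<in>UNIV - {x}. g v (z v))"
  have zx: "z x \<ge> 0" using z by (simp add: orthant_def)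
  have "((\<lambda>t. g x t * C) has_real_derivative g' (z x) * C) (at (z x) within {0..})"
    using g[OF zx] by (rule DERIV_cmult_right)
  then have "((\<lambda>t. f (z(x := t))) has_real_derivative g' (z x) * C) (at (z x) within {0..})"
    using zx
  proof (rule has_real_derivative_halfline_cong)
    show "f (z(x := t)) = g x t * C" if "t \<ge> 0" for t
      using z that by (simp add: f C_def prod.remove[of UNIV x])
  qed
  moreover have "(\<Prod>v\<in>UNIV. (g(x := g')) v (z v)) = g' (z x) * C"
    by (simp add: C_def prod.remove[of UNIV x])
  ultimately show ?thesis by simp
qed

lemma partial_deriv_product_form:
  fixes f :: "('v::finite \<Rightarrow> real) \<Rightarrow> real" and g :: "'v \<Rightarrow> real \<Rightarrow> real"
  assumes "\<And>w. w \<in> orthant \<Longrightarrow> f w = (\<Prod>v\<in>UNIV. g v (w v))"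
    and "\<And>t. t \<ge> 0 \<Longrightarrow> (g x has_real_derivative g' t) (at t within {0..})"
    and "z \<in> orthant"
  shows "partial_deriv x f z = (\<Prod>v\<in>UNIV. (g(x := g')) v (z v))"
  by (rule partial_derivI[OF has_derivative_product_form]) (use assms in auto)

text \<open>The first difference of derivatives is a difference of two products, each again of
  product form. The two mixed terms coincide because updates at distinct sites commute.\<close>

lemma deriv_diff_deriv_diff_product_form:
  fixes f :: "('v::finite \<Rightarrow> real) \<Rightarrow> real" and g :: "'v \<Rightarrow> real \<Rightarrow> real"
  assumes "x \<noteq> y"
    and f: "\<And>w. w \<in> orthant \<Longrightarrow> f w = (\<Prod>v\<in>UNIV. g v (w v))"
    and gx: "\<And>t. t \<ge> 0 \<Longrightarrow> (g x has_real_derivative g1 t) (at t within {0..})"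
    and gxx: "\<And>t. t \<ge> 0 \<Longrightarrow> (g1 has_real_derivative g2 t) (at t within {0..})"
    and gy: "\<And>t. t \<ge> 0 \<Longrightarrow> (g y has_real_derivative h1 t) (at t within {0..})"
    and gyy: "\<And>t. t \<ge> 0 \<Longrightarrow> (h1 has_real_derivative h2 t) (at t within {0..})"
    and z: "z \<in> orthant"
  shows "deriv_diff x y (deriv_diff x y f) z =
    ((\<Prod>v\<in>UNIV. (g(x := g2)) v (z v)) - (\<Prod>v\<in>UNIV. (g(x := g1, y := h1)) v (z v))) -
    ((\<Prod>v\<in>UNIV. (g(x := g1, y := h1)) v (z v)) - (\<Prod>v\<in>UNIV. (g(y := h2)) v (z v)))"
proof -
  define fx where "fx w = (\<Prod>v\<in>UNIV. (g(x := g1)) v (w v))" for w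
  define fy where "fy w = (\<Prod>v\<in>UNIV. (g(y := h1)) v (w v))" for w
  have zpos: "z v \<ge> 0" for v using z by (simp add: orthant_def)
  have dd: "deriv_diff x y f w = fx w - fy w" if "w \<in> orthant" for w
    unfolding deriv_diff_def fx_def fy_def
    using partial_deriv_product_form[OF f gx that] partial_deriv_product_form[OF f gy that] by simp
  have swap: "g(y := h1, x := g1) = g(x := g1, y := h1)" using \<open>x \<noteq> y\<close> by (simp add: fun_upd_twist)
  have "((\<lambda>t. fx (z(x := t)) - fy (z(x := t))) has_real_derivative
    (\<Prod>v\<in>UNIV. (g(x := g1, x := g2)) v (z v)) - (\<Prod>v\<in>UNIV. (g(y := h1, x := g1)) v (z v)))
    (at (z x) within {0..})"
    by (intro DERIV_diff has_derivative_product_form)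
      (use gx gxx z \<open>x \<noteq> y\<close> in \<open>simp_all add: fx_def fy_def\<close>)
  then have x: "partial_deriv x (deriv_diff x y f) z =
    (\<Prod>v\<in>UNIV. (g(x := g2)) v (z v)) - (\<Prod>v\<in>UNIV. (g(x := g1, y := h1)) v (z v))"
    unfolding swap fun_upd_upd
    by (intro partial_derivI[OF has_real_derivative_halfline_cong] z zpos) (auto simp: dd z zpos)
  have "((\<lambda>t. fx (z(y := t)) - fy (z(y := t))) has_real_derivative
    (\<Prod>v\<in>UNIV. (g(x := g1, y := h1)) v (z v)) - (\<Prod>v\<in>UNIV. (g(y := h1, y := h2)) v (z v)))
    (at (z y) within {0..})"
    by (intro DERIV_diff has_derivative_product_form)
      (use gy gyy z \<open>x \<noteq> y\<close> in \<open>simp_all add: fx_def fy_def\<close>)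
  then have y: "partial_deriv y (deriv_diff x y f) z =
    (\<Prod>v\<in>UNIV. (g(x := g1, y := h1)) v (z v)) - (\<Prod>v\<in>UNIV. (g(y := h2)) v (z v))"
    unfolding fun_upd_upd
    by (intro partial_derivI[OF has_real_derivative_halfline_cong] z zpos) (auto simp: dd z zpos)
  show ?thesis unfolding deriv_diff_def[of x y "deriv_diff x y f"] x y ..
qed

lemma prod_remove2:
  fixes F :: "'v::finite \<Rightarrow> real"
  assumes "x \<noteq> y"
  shows "prod F UNIV = prod F (UNIV - {x, y}) * (F x * F y)"
proof -
  have "UNIV - {x, y} = UNIV - {x} - {y}" by auto
  then show ?thesis
    using assms by (simp add: prod.remove[of UNIV x] prod.remove[of "UNIV - {x}" y] mult_ac)
qed

text \<open>The factors at sites other than x and y are untouched by the edge operator and can be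
  pulled out, leaving an expression in two variables.\<close>

lemma bep_edge_product_form:
  fixes f :: "('v::finite \<Rightarrow> real) \<Rightarrow> real" and g :: "'v \<Rightarrow> real \<Rightarrow> real"
  assumes "x \<noteq> y"
    and f: "\<And>w. w \<in> orthant \<Longrightarrow> f w = (\<Prod>v\<in>UNIV. g v (w v))"
    and gx: "\<And>t. t \<ge> 0 \<Longrightarrow> (g x has_real_derivative g1 t) (at t within {0..})"
    and gxx: "\<And>t. t \<ge> 0 \<Longrightarrow> (g1 has_real_derivative g2 t) (at t within {0..})"
    and gy: "\<And>t. t \<ge> 0 \<Longrightarrow> (g y has_real_derivative h1 t) (at t within {0..})"
    and gyy: "\<And>t. t \<ge> 0 \<Longrightarrow> (h1 has_real_derivative h2 t) (at t within {0..})"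
    and z: "z \<in> orthant"
  shows "bep_edge \<alpha> x y f z = (\<Prod>v\<in>UNIV - {x, y}. g v (z v)) *
    (- \<alpha> * (z x - z y) * (g1 (z x) * g y (z y) - g x (z x) * h1 (z y)) +
     z x * z y * (g2 (z x) * g y (z y) - 2 * (g1 (z x) * h1 (z y)) + g x (z x) * h2 (z y)))"
proof -
  have other:
    "(\<Prod>v\<in>UNIV - {x, y}. (g(x := s)) v (z v)) = (\<Prod>v\<in>UNIV - {x, y}. g v (z v))"
    "(\<Prod>v\<in>UNIV - {x, y}. (g(y := t)) v (z v)) = (\<Prod>v\<in>UNIV - {x, y}. g v (z v))"
    "(\<Prod>v\<in>UNIV - {x, y}. (g(x := s, y := t)) v (z v)) = (\<Prod>v\<in>UNIV - {x, y}. g v (z v))"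
    for s t
    by (auto intro!: prod.cong)
  have dd: "deriv_diff x y f z =
    (\<Prod>v\<in>UNIV. (g(x := g1)) v (z v)) - (\<Prod>v\<in>UNIV. (g(y := h1)) v (z v))"
    unfolding deriv_diff_def
    using partial_deriv_product_form[OF f gx z] partial_deriv_product_form[OF f gy z] by simp
  have dd2: "deriv_diff x y (deriv_diff x y f) z =
    ((\<Prod>v\<in>UNIV. (g(x := g2)) v (z v)) - (\<Prod>v\<in>UNIV. (g(x := g1, y := h1)) v (z v))) -
    ((\<Prod>v\<in>UNIV. (g(x := g1, y := h1)) v (z v)) - (\<Prod>v\<in>UNIV. (g(y := h2)) v (z v)))"
    by (rule deriv_diff_deriv_diff_product_form) (use assms in auto)
  show ?thesis
    unfolding bep_edge_def dd dd2 prod_remove2[OF \<open>x \<noteq> y\<close>] other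
    using \<open>x \<noteq> y\<close> by (simp add: algebra_simps)
qed

lemma poly_has_real_derivative_within:
  "(poly p has_real_derivative poly (pderiv p) t) (at t within S)"
  by (rule has_field_derivative_at_within) (rule poly_DERIV)

text \<open>Polynomial products are closed under partial differentiation on the orthant, so the
  local fact \<open>diff\<close>, general in \<open>f\<close> and \<open>q\<close>, handles both
  orders.\<close>

lemma twice_partially_differentiable_poly_product:
  fixes f :: "('v::finite \<Rightarrow> real) \<Rightarrow> real" and q :: "'v \<Rightarrow> real poly"
  assumes f: "\<And>w. w \<in> orthant \<Longrightarrow> f w = (\<Prod>v\<in>UNIV. poly (q v) (w v))"
  shows "twice_partially_differentiable f"
  unfolding twice_partially_differentiable_def
proof (intro ballI allI conjI)
  fix z :: "'v \<Rightarrow> real" and x y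
  assume z: "z \<in> orthant"
  have diff: "(\<lambda>t. f (z(x := t))) differentiable (at (z x) within {0..})"
    if f: "\<And>w. w \<in> orthant \<Longrightarrow> f w = (\<Prod>v\<in>UNIV. poly (q v) (w v))" for f q x
    using has_derivative_product_form[OF f poly_has_real_derivative_within z]
    unfolding has_field_derivative_def by (rule differentiableI)
  show "(\<lambda>t. f (z(x := t))) differentiable (at (z x) within {0..})"
    by (rule diff[OF f])
  show "(\<lambda>t. partial_deriv x f (z(y := t))) differentiable (at (z y) within {0..})"
  proof (rule diff)
    fix w :: "'v \<Rightarrow> real" assume "w \<in> orthant"
    then have "partial_deriv x f w =
      (\<Prod>v\<in>UNIV. ((\<lambda>v. poly (q v))(x := poly (pderiv (q x)))) v (w v))"
      by (intro partial_deriv_product_form f poly_has_real_derivative_within)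
    also have "\<dots> = (\<Prod>v\<in>UNIV. poly ((q(x := pderiv (q x))) v) (w v))"
      by (intro prod.cong) auto
    finally show "partial_deriv x f w = (\<Prod>v\<in>UNIV. poly ((q(x := pderiv (q x))) v) (w v))" .
  qed
qed

section \<open>Duality\<close>

text \<open>(A), (B) and (C) evaluated at a point, with (A) and (B) solved for the multiples of k
  e_{k-1} that occur in the edge identity.\<close>

lemma poly_duality_poly_relations:
  fixes \<alpha> a b :: real
  assumes "\<alpha> > 0"
  defines "e \<equiv> duality_poly \<alpha> a b"
  shows "a * (real k * poly (e (k - 1)) u) = real k * poly (e k) u - u * poly (pderiv (e k)) u" (is ?A)
    and "b * \<alpha> * (real k * poly (e (k - 1)) u) =
      u * poly (pderiv (pderiv (e k))) u + \<alpha> * poly (pderiv (e k)) u" (is ?B)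
    and "(\<alpha> + real k) * poly (e (Suc k)) u =
      a * (\<alpha> + real k) * poly (e k) u + u * (a * poly (pderiv (e k)) u + b * \<alpha> * poly (e k) u)" (is ?C)
proof -
  show ?A
    using arg_cong[OF pCons_pderiv_duality_poly[of \<alpha> a b k], of "\<lambda>p. poly p u"]
    by (simp add: e_def algebra_simps)
  show ?B
    using arg_cong[OF second_pderiv_duality_poly[OF assms(1), of a b k], of "\<lambda>p. poly p u"]
    by (simp add: e_def algebra_simps)
  show ?C
    using arg_cong[OF duality_poly_Suc[OF assms(1), of k a b], of "\<lambda>p. poly p u"]
    by (simp add: e_def algebra_simps)
qed

text \<open>The algebraic core of edge duality. Here e, e1, e2 stand for e_k(u) and its derivatives,
  p for k e_{k-1}(u), r for (alpha+k) e_{k+1}(u), and B for b alpha; f, f1, f2, q, s are the same at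
  (n, v). The left side is the SIP action, the right side the BEP action.\<close>

lemma edge_duality_identity:
  fixes a B \<alpha> k n u v e e1 e2 p r f f1 f2 q s :: real
  assumes "a * p = k * e - u * e1" "B * p = u * e2 + \<alpha> * e1"
    and "a * q = n * f - v * f1" "B * q = v * f2 + \<alpha> * f1"
    and "r = a * (\<alpha> + k) * e + u * (a * e1 + B * e)"
    and "s = a * (\<alpha> + n) * f + v * (a * f1 + B * f)"
  shows "p * s - k * (\<alpha> + n) * (e * f) + (q * r - n * (\<alpha> + k) * (e * f)) =
    - \<alpha> * (u - v) * (e1 * f - e * f1) + u * v * (e2 * f - 2 * (e1 * f1) + e * f2)"
proof -
  \<comment> \<open>After inserting s, the variable p occurs only in \<open>a * p\<close> and
    \<open>B * p\<close>, exactly the combinations given by (A) and (B).\<close>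
  have "p * s = (\<alpha> + n) * (a * p) * f + v * f1 * (a * p) + v * f * (B * p)"
    unfolding assms(6) by algebra
  moreover have "q * r = (\<alpha> + k) * (a * q) * e + u * e1 * (a * q) + u * e * (B * q)"
    unfolding assms(5) by algebra
  ultimately show ?thesis
    unfolding assms(1-4) by algebra
qed

text \<open>For an empty site x the truncated \<open>\<xi> x - 1\<close> agrees with the junk value
  of \<open>move\<close>, so the formula holds for every configuration.\<close>

lemma factorized_move:
  fixes \<xi> :: "'v::finite \<Rightarrow> nat"
  assumes "x \<noteq> y"
  shows "factorized d (move x y \<xi>) z =
    (\<Prod>v\<in>UNIV - {x, y}. d (\<xi> v) (z v)) * (d (\<xi> x - 1) (z x) * d (Suc (\<xi> y)) (z y))"
proof -
  have "(\<Prod>v\<in>UNIV - {x, y}. d (move x y \<xi> v) (z v)) = (\<Prod>v\<in>UNIV - {x, y}. d (\<xi> v) (z v))"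
    by (intro prod.cong) (auto simp: move_def)
  then show ?thesis
    using assms unfolding factorized_def prod_remove2[OF assms] by (simp add: move_def)
qed

lemma duality_poly_edge_dual:
  fixes \<xi> :: "'v::finite \<Rightarrow> nat"
  assumes "\<alpha> > 0" "x \<noteq> y"
    and d: "\<And>k t. t \<ge> 0 \<Longrightarrow> d k t = poly (duality_poly \<alpha> a b k) t"
    and z: "z \<in> orthant"
  shows "sip_edge \<alpha> x y (\<lambda>\<eta>. factorized d \<eta> z) \<xi> = bep_edge \<alpha> x y (factorized d \<xi>) z"
proof -
  let ?e = "duality_poly \<alpha> a b"
  define R where "R = (\<Prod>v\<in>UNIV - {x, y}. d (\<xi> v) (z v))"
  have zpos: "z v \<ge> 0" for v using z by (simp add: orthant_def)
  have comm: "UNIV - {y, x} = UNIV - {x, y}" by auto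
  have "bep_edge \<alpha> x y (factorized d \<xi>) z = (\<Prod>v\<in>UNIV - {x, y}. poly (?e (\<xi> v)) (z v)) *
    (- \<alpha> * (z x - z y) * (poly (pderiv (?e (\<xi> x))) (z x) * poly (?e (\<xi> y)) (z y) -
        poly (?e (\<xi> x)) (z x) * poly (pderiv (?e (\<xi> y))) (z y)) +
     z x * z y * (poly (pderiv (pderiv (?e (\<xi> x)))) (z x) * poly (?e (\<xi> y)) (z y) -
        2 * (poly (pderiv (?e (\<xi> x))) (z x) * poly (pderiv (?e (\<xi> y))) (z y)) +
        poly (?e (\<xi> x)) (z x) * poly (pderiv (pderiv (?e (\<xi> y)))) (z y)))"
    by (rule bep_edge_product_form[OF assms(2)])
      (use z in \<open>auto intro: poly_has_real_derivative_within simp: factorized_def d orthant_def\<close>)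
  also have "(\<Prod>v\<in>UNIV - {x, y}. poly (?e (\<xi> v)) (z v)) = R"
    by (simp add: R_def d zpos)
  also note edge_duality_identity[OF
      poly_duality_poly_relations(1,2)[OF assms(1), where k = "\<xi> x" and u = "z x"]
      poly_duality_poly_relations(1,2)[OF assms(1), where k = "\<xi> y" and u = "z y"]
      poly_duality_poly_relations(3)[OF assms(1), where k = "\<xi> x" and u = "z x"]
      poly_duality_poly_relations(3)[OF assms(1), where k = "\<xi> y" and u = "z y"], symmetric]
  finally have "bep_edge \<alpha> x y (factorized d \<xi>) z = R *
    (real (\<xi> x) * poly (?e (\<xi> x - 1)) (z x) * ((\<alpha> + real (\<xi> y)) * poly (?e (Suc (\<xi> y))) (z y)) -
     real (\<xi> x) * (\<alpha> + real (\<xi> y)) * (poly (?e (\<xi> x)) (z x) * poly (?e (\<xi> y)) (z y)) +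
     (real (\<xi> y) * poly (?e (\<xi> y - 1)) (z y) * ((\<alpha> + real (\<xi> x)) * poly (?e (Suc (\<xi> x))) (z x)) -
     real (\<xi> y) * (\<alpha> + real (\<xi> x)) * (poly (?e (\<xi> x)) (z x) * poly (?e (\<xi> y)) (z y))))" .
  moreover have "factorized d \<xi> z = R * (d (\<xi> x) (z x) * d (\<xi> y) (z y))"
    unfolding factorized_def R_def by (rule prod_remove2[OF assms(2)])
  ultimately show ?thesis
    unfolding sip_edge_def factorized_move[OF assms(2)] factorized_move[OF assms(2)[symmetric]]
      comm R_def[symmetric]
    by (simp add: d zpos algebra_simps)
qed

text \<open>Duality is summed over the edges. The edge identity covers distinct sites; the diagonal
  terms carry the rate \<open>p x x\<close>, which is 0.\<close>

lemma dual_generators_duality_poly: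
  fixes p :: "'v::finite \<Rightarrow> 'v \<Rightarrow> real"
  assumes "\<alpha> > 0" "\<And>x. p x x = 0"
    and d: "\<And>k t. t \<ge> 0 \<Longrightarrow> d k t = poly (duality_poly \<alpha> a b k) t"
  shows "dual_generators (sip_generator p \<alpha>) (bep_generator p \<alpha>)
    (factorized d :: ('v \<Rightarrow> nat) \<Rightarrow> ('v \<Rightarrow> real) \<Rightarrow> real)"
  unfolding dual_generators_def
proof (intro conjI allI ballI)
  fix \<xi> :: "'v \<Rightarrow> nat"
  show "twice_partially_differentiable (factorized d \<xi>)"
    by (rule twice_partially_differentiable_poly_product[where q = "\<lambda>v. duality_poly \<alpha> a b (\<xi> v)"])
      (simp add: factorized_def d orthant_def)
next
  fix \<xi> :: "'v \<Rightarrow> nat" and z :: "'v \<Rightarrow> real"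
  assume z: "z \<in> orthant"
  have "p x y * sip_edge \<alpha> x y (\<lambda>\<eta>. factorized d \<eta> z) \<xi> = p x y * bep_edge \<alpha> x y (factorized d \<xi>) z" for x y
    using duality_poly_edge_dual[OF assms(1) _ d z, where x = x and y = y] assms(2)
    by (cases "x = y") auto
  then show "sip_generator p \<alpha> (\<lambda>\<eta>. factorized d \<eta> z) \<xi> = bep_generator p \<alpha> (factorized d \<xi>) z"
    unfolding sip_generator_def bep_generator_def by (simp only:)
qed

section \<open>Necessity: edge duality determines the single-site functions\<close>

text \<open>Edge duality is tested on k particles at \<open>False\<close> and none at
  \<open>True\<close>. Since d(0,.) = 1, the product depends on u alone, and the jump out of the
  empty site has rate zero.\<close>

lemma dual_edge_generators_imp_equation:
  assumes d0: "\<forall>z\<ge>0. d 0 z = 1"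
    and dual: "dual_edge_generators \<alpha> d"
  shows "\<exists>d1 d2 :: real \<Rightarrow> real.
    (\<forall>t\<ge>0. (d k has_real_derivative d1 t) (at t within {0..})) \<and>
    (\<forall>t\<ge>0. (d1 has_real_derivative d2 t) (at t within {0..})) \<and>
    (\<forall>u\<ge>0. \<forall>v\<ge>0. real k * \<alpha> * (d (k - 1) u * d 1 v - d k u) =
      - \<alpha> * (u - v) * d1 u + u * v * d2 u)"
proof -
  define \<xi> :: "bool \<Rightarrow> nat" where "\<xi> = (\<lambda>s. if s then 0 else k)"
  define f where "f w = d (\<xi> False) (w False) * d (\<xi> True) (w True)" for w :: "bool \<Rightarrow> real"
  define z where "z u v = (\<lambda>s. if s then v else u)" for u v :: real
  have z: "z u v \<in> orthant" "z u v False = u" "z u v True = v" "(z u v)(False := t) = z t v"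
    if "u \<ge> 0" "v \<ge> 0" for u v t
    using that by (auto simp: z_def orthant_def)
  have tpd: "twice_partially_differentiable f"
    and eq: "\<And>z. z \<in> orthant \<Longrightarrow> sip_edge \<alpha> False True
      (\<lambda>\<eta>. d (\<eta> False) (z False) * d (\<eta> True) (z True)) \<xi> = bep_edge \<alpha> False True f z"
    using dual unfolding dual_edge_generators_def dual_generators_def f_def by auto
  have f: "f (z t v) = d k t" if "v \<ge> 0" for t v
    using that by (simp add: f_def \<xi>_def z_def d0)
  define d1 where "d1 t = vector_derivative (d k) (at t within {0..})" for t
  define d2 where "d2 t = vector_derivative d1 (at t within {0..})" for t
  have der1: "(d k has_real_derivative d1 t) (at t within {0..})" if "t \<ge> 0" for t
  proof -
    have "(\<lambda>s. f ((z t 0)(False := s))) differentiable (at (z t 0 False) within {0..})"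
      using tpd z(1)[OF that order_refl] unfolding twice_partially_differentiable_def by blast
    then have "d k differentiable (at t within {0..})"
      using that by (simp add: z f)
    then show ?thesis
      unfolding d1_def by (simp add: has_real_derivative_iff_has_vector_derivative vector_derivative_works)
  qed
  have pd: "partial_deriv False f (z t 0) = d1 t" if "t \<ge> 0" for t
    using that by (simp add: partial_deriv_def d1_def z f)
  have der2: "(d1 has_real_derivative d2 t) (at t within {0..})" if "t \<ge> 0" for t
  proof -
    \<comment> \<open>\<open>?h\<close> is known to equal \<open>d1\<close> for nonnegative
      arguments only, hence the detour through a congruence on the half-line.\<close>
    let ?h = "\<lambda>s. partial_deriv False f (z s 0)"
    have "(\<lambda>s. partial_deriv False f ((z t 0)(False := s))) differentiable (at (z t 0 False) within {0..})"
      using tpd z(1)[OF that order_refl] unfolding twice_partially_differentiable_def by blast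
    then have "?h differentiable (at t within {0..})"
      using that by (simp add: z)
    then obtain D where "(?h has_real_derivative D) (at t within {0..})"
      by (auto simp: has_real_derivative_iff_has_vector_derivative vector_derivative_works)
    then have D: "(d1 has_real_derivative D) (at t within {0..})"
      by (rule has_real_derivative_halfline_cong) (use that pd in auto)
    then show ?thesis
      unfolding d2_def vector_derivative_halfline[OF D that] .
  qed
  have "real k * \<alpha> * (d (k - 1) u * d 1 v - d k u) = - \<alpha> * (u - v) * d1 u + u * v * d2 u"
    if "u \<ge> 0" "v \<ge> 0" for u v
  proof -
    \<comment> \<open>The factor at \<open>True\<close> is the constant 1, which \<open>d 0\<close>
      equals on the half-line; both its derivatives are 0.\<close>
    define g where "g = (\<lambda>s. if s then (\<lambda>t::real. 1) else d k)"
    have "bep_edge \<alpha> False True f (z u v) = (\<Prod>s\<in>UNIV - {False, True}. g s (z u v s)) *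
      (- \<alpha> * (z u v False - z u v True) * (d1 (z u v False) * g True (z u v True) - g False (z u v False) * 0) +
       z u v False * z u v True * (d2 (z u v False) * g True (z u v True) - 2 * (d1 (z u v False) * 0) +
         g False (z u v False) * 0))"
      by (rule bep_edge_product_form)
        (use that der1 der2 z d0 in \<open>auto simp: f_def g_def \<xi>_def UNIV_bool orthant_def\<close>)
    also have "\<dots> = - \<alpha> * (u - v) * d1 u + u * v * d2 u"
      using that by (simp add: z g_def flip: UNIV_bool)
    finally show ?thesis
      using eq[OF z(1)[OF that]] that by (simp add: sip_edge_def move_def \<xi>_def z d0)
  qed
  with der1 der2 show ?thesis by blast
qed

lemma dual_edge_generators_imp_duality_poly:
  assumes "\<alpha> > 0"
    and d0: "\<forall>z\<ge>0. d 0 z = 1"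
    and dual: "dual_edge_generators \<alpha> d"
  obtains a b where "\<And>z. z \<ge> 0 \<Longrightarrow> d 1 z = a + b * z"
    and "\<And>k z. z \<ge> 0 \<Longrightarrow> d k z = poly (duality_poly \<alpha> a b k) z"
proof -
  obtain d1 d2 :: "real \<Rightarrow> real" where "\<And>u v. u \<ge> 0 \<Longrightarrow> v \<ge> 0 \<Longrightarrow>
    real 1 * \<alpha> * (d (1 - 1) u * d 1 v - d 1 u) = - \<alpha> * (u - v) * d1 u + u * v * d2 u"
    using dual_edge_generators_imp_equation[OF d0 dual, of 1] by blast
  \<comment> \<open>At u = 0 the second-order term disappears, so d(1,.) is affine with slope
    \<open>d1 0\<close>; this yields the witnesses a = d(1,0) and b = \<open>d1 0\<close>.\<close>
  from this[of 0] have *: "\<alpha> * (d 1 v - d 1 0) = \<alpha> * (v * d1 0)" if "v \<ge> 0" for v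
    using that by (simp add: d0)
  have lin: "d 1 v = d 1 0 + d1 0 * v" if "v \<ge> 0" for v
  proof -
    have "d 1 v - d 1 0 = v * d1 0"
      using *[OF that] assms(1) by (metis less_irrefl mult_left_cancel)
    then show ?thesis by (simp add: mult.commute)
  qed
  define a where "a = d 1 0"
  define b where "b = d1 0"
  let ?e = "duality_poly \<alpha> a b"
  have "\<forall>z\<ge>0. d k z = poly (?e k) z" for k
  proof (induction k)
    case 0
    then show ?case by (simp add: d0)
  next
    case (Suc m)
    obtain d1 d2 :: "real \<Rightarrow> real" where
      der1: "\<And>t. t \<ge> 0 \<Longrightarrow> (d (Suc m) has_real_derivative d1 t) (at t within {0..})" and
      der2: "\<And>t. t \<ge> 0 \<Longrightarrow> (d1 has_real_derivative d2 t) (at t within {0..})" and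
      eq1: "\<And>u v. u \<ge> 0 \<Longrightarrow> v \<ge> 0 \<Longrightarrow> real (Suc m) * \<alpha> * (d m u * d 1 v - d (Suc m) u) =
        - \<alpha> * (u - v) * d1 u + u * v * d2 u"
      using dual_edge_generators_imp_equation[OF d0 dual, of "Suc m", unfolded diff_Suc_1] by blast
    have eq: "real (Suc m) * \<alpha> * (d m u * (a + b * v) - d (Suc m) u) =
        - \<alpha> * (u - v) * d1 u + u * v * d2 u" if "u \<ge> 0" "v \<ge> 0" for u v
      using eq1[OF that] unfolding lin[OF that(2)] a_def b_def .
    \<comment> \<open>The constant coefficient in v, read off at v = 0: relation (A) for the unknown
      d(m+1,.).\<close>
    have first: "u * d1 u = real (Suc m) * (d (Suc m) u - a * d m u)" if "u \<ge> 0" for u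
    proof -
      have "\<alpha> * (u * d1 u) = \<alpha> * (real (Suc m) * (d (Suc m) u - a * d m u))"
        using eq[OF that, of 0] by (simp add: algebra_simps)
      then show ?thesis using assms(1) by simp
    qed
    \<comment> \<open>The coefficient of v, as the difference of the values at v = 1 and v = 0:
      relation (B).\<close>
    have second: "u * d2 u + \<alpha> * d1 u = real (Suc m) * (b * \<alpha>) * d m u" if "u \<ge> 0" for u
      using eq[OF that, of 0] eq[OF that, of 1] by (simp add: algebra_simps)
    have derm: "(d m has_real_derivative poly (pderiv (?e m)) u) (at u within {0..})" if "u \<ge> 0" for u
      by (rule has_real_derivative_halfline_cong[OF poly_has_real_derivative_within that]) (use Suc in auto)
    show ?case
    proof (intro allI impI)
      fix u :: real assume u: "u \<ge> 0"
      \<comment> \<open>Both sides of \<open>first\<close> are differentiated; combined with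
        \<open>second\<close>, this eliminates \<open>d2\<close> and expresses \<open>d1\<close>
        through d(m,.).\<close>
      have "((\<lambda>u. u * d1 u) has_real_derivative 1 * d1 u + d2 u * u) (at u within {0..})"
        by (intro DERIV_mult DERIV_ident der2 u)
      then have "((\<lambda>u. real (Suc m) * (d (Suc m) u - a * d m u)) has_real_derivative
          1 * d1 u + d2 u * u) (at u within {0..})"
        by (rule has_real_derivative_halfline_cong[OF _ u]) (simp only: first)
      moreover have "((\<lambda>u. real (Suc m) * (d (Suc m) u - a * d m u)) has_real_derivative
          real (Suc m) * (d1 u - a * poly (pderiv (?e m)) u)) (at u within {0..})"
        by (intro DERIV_cmult DERIV_diff der1 derm u)
      ultimately have "1 * d1 u + d2 u * u = real (Suc m) * (d1 u - a * poly (pderiv (?e m)) u)"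
        by (rule has_real_derivative_halfline_unique) (rule u)
      with second[OF u] have "(\<alpha> + real m) * d1 u =
          real (Suc m) * (a * poly (pderiv (?e m)) u + b * \<alpha> * d m u)"
        by (simp add: algebra_simps)
      \<comment> \<open>Multiplying by u lets \<open>first\<close> eliminate \<open>d1\<close> as
        well, which leaves the recursion (C).\<close>
      then have "real (Suc m) * ((\<alpha> + real m) * (d (Suc m) u - a * d m u)) =
          real (Suc m) * (u * (a * poly (pderiv (?e m)) u + b * \<alpha> * d m u))"
      proof -
        assume h: "(\<alpha> + real m) * d1 u = real (Suc m) * (a * poly (pderiv (?e m)) u + b * \<alpha> * d m u)"
        have "real (Suc m) * ((\<alpha> + real m) * (d (Suc m) u - a * d m u)) = (\<alpha> + real m) * (u * d1 u)"
          unfolding first[OF u] by (simp only: mult.left_commute)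
        also have "\<dots> = u * ((\<alpha> + real m) * d1 u)" by (simp only: mult.left_commute)
        also have "\<dots> = real (Suc m) * (u * (a * poly (pderiv (?e m)) u + b * \<alpha> * d m u))"
          unfolding h by (simp only: mult.left_commute)
        finally show ?thesis .
      qed
      then have "(\<alpha> + real m) * (d (Suc m) u - a * d m u) =
          u * (a * poly (pderiv (?e m)) u + b * \<alpha> * d m u)"
        by (simp del: of_nat_Suc)
      then have "(\<alpha> + real m) * d (Suc m) u = (\<alpha> + real m) * poly (?e (Suc m)) u"
        unfolding poly_duality_poly_relations(3)[OF assms(1)] using Suc u by (simp add: algebra_simps)
      then show "d (Suc m) u = poly (?e (Suc m)) u" using assms(1) by simp
    qed
  qed
  then show thesis
    by (intro that[of a b]) (rule lin[folded a_def b_def], assumption, blast)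
qed

theorem mainTheorem3:
  fixes p :: "'v::finite \<Rightarrow> 'v \<Rightarrow> real" and \<alpha> :: real
  assumes "\<alpha> > 0"
    and "\<And>x y. p x y \<ge> 0"
    and "\<And>x. p x x = 0"
    and "irreducible_rates p"
  shows
    "(\<forall>(d :: nat \<Rightarrow> real \<Rightarrow> real) P Q.
        (\<forall>z\<ge>0. d 0 z = 1) \<longrightarrow>
        sip_process p \<alpha> P \<longrightarrow>
        bep_process p \<alpha> Q \<longrightarrow>
        dual_processes P Q (factorized d) \<longrightarrow>
        dual_edge_generators \<alpha> d \<longrightarrow>
        (\<forall>l>0. \<forall>\<xi> :: 'v \<Rightarrow> nat.
           integrable (PiM UNIV (\<lambda>_. gamma_measure \<alpha> l)) (factorized d \<xi>)) \<longrightarrow>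
        (\<exists>a b :: real.
           (\<forall>z\<ge>0. d 1 z = a + b * z) \<and>
           (\<forall>k. has_laplace_transform
                  (\<lambda>z. d k z * (z powr (\<alpha> - 1) / Gamma \<alpha>))
                  (\<lambda>l. (a * l + b * \<alpha>) ^ k * l powr (- \<alpha> - real k))) \<and>
           (a = 0 \<longrightarrow>
              (\<forall>k. \<forall>z\<ge>0. d k z = (b * \<alpha>) ^ k * (z ^ k * Gamma \<alpha> / Gamma (\<alpha> + real k)))) \<and>
           (a \<noteq> 0 \<longrightarrow>
              (\<forall>k. \<forall>z\<ge>0. d k z = a ^ k * hyp1F1_neg k \<alpha> (- (b * \<alpha> / a) * z))) \<and>
           (a * b < 0 \<longrightarrow>
              (\<forall>k. \<forall>z\<ge>0. d k z = a ^ k * (fact k * Gamma \<alpha> / Gamma (\<alpha> + real k)) *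
                                 laguerre k (\<alpha> - 1) (- (b * \<alpha> / a)) z)))) \<and>
     (\<forall>\<mu>>0. \<forall>j k. j \<noteq> k \<longrightarrow>
        has_bochner_integral (gamma_measure \<alpha> \<mu>)
          (\<lambda>z. laguerre j (\<alpha> - 1) \<mu> z * laguerre k (\<alpha> - 1) \<mu> z) 0) \<and>
     (\<forall>(d :: nat \<Rightarrow> real \<Rightarrow> real) (a :: real) (b :: real).
        (a = 0 \<and>
           (\<forall>k. \<forall>z\<ge>0. d k z = (b * \<alpha>) ^ k * (z ^ k * Gamma \<alpha> / Gamma (\<alpha> + real k)))) \<or>
        (a \<noteq> 0 \<and>
           (\<forall>k. \<forall>z\<ge>0. d k z = a ^ k * hyp1F1_neg k \<alpha> (- (b * \<alpha> / a) * z))) \<or>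
        (a * b < 0 \<and>
           (\<forall>k. \<forall>z\<ge>0. d k z = a ^ k * (fact k * Gamma \<alpha> / Gamma (\<alpha> + real k)) *
                              laguerre k (\<alpha> - 1) (- (b * \<alpha> / a)) z)) \<longrightarrow>
        dual_generators (sip_generator p \<alpha>) (bep_generator p \<alpha>)
          (factorized d :: ('v \<Rightarrow> nat) \<Rightarrow> ('v \<Rightarrow> real) \<Rightarrow> real))"
proof (intro conjI allI impI)
  fix d :: "nat \<Rightarrow> real \<Rightarrow> real"
  assume d0: "\<forall>z\<ge>0. d 0 z = 1" and dual: "dual_edge_generators \<alpha> d"
  obtain a b where d1: "\<And>z. z \<ge> 0 \<Longrightarrow> d 1 z = a + b * z"
    and d: "\<And>k z. z \<ge> 0 \<Longrightarrow> d k z = poly (duality_poly \<alpha> a b k) z"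
    using dual_edge_generators_imp_duality_poly[OF assms(1) d0 dual] by blast
  have hyp: "d k z = a ^ k * hyp1F1_neg k \<alpha> (- (b * \<alpha> / a) * z)" if "a \<noteq> 0" "z \<ge> 0" for k z
    unfolding d[OF that(2)] using that(1) by (rule poly_duality_poly_eq_hyp1F1_neg)
  show "\<exists>a b :: real.
           (\<forall>z\<ge>0. d 1 z = a + b * z) \<and>
           (\<forall>k. has_laplace_transform
                  (\<lambda>z. d k z * (z powr (\<alpha> - 1) / Gamma \<alpha>))
                  (\<lambda>l. (a * l + b * \<alpha>) ^ k * l powr (- \<alpha> - real k))) \<and>
           (a = 0 \<longrightarrow>
              (\<forall>k. \<forall>z\<ge>0. d k z = (b * \<alpha>) ^ k * (z ^ k * Gamma \<alpha> / Gamma (\<alpha> + real k)))) \<and>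
           (a \<noteq> 0 \<longrightarrow>
              (\<forall>k. \<forall>z\<ge>0. d k z = a ^ k * hyp1F1_neg k \<alpha> (- (b * \<alpha> / a) * z))) \<and>
           (a * b < 0 \<longrightarrow>
              (\<forall>k. \<forall>z\<ge>0. d k z = a ^ k * (fact k * Gamma \<alpha> / Gamma (\<alpha> + real k)) *
                                 laguerre k (\<alpha> - 1) (- (b * \<alpha> / a)) z))"
  proof (rule exI[of _ a], rule exI[of _ b], intro conjI allI impI)
    fix k
    show "has_laplace_transform (\<lambda>z. d k z * (z powr (\<alpha> - 1) / Gamma \<alpha>))
      (\<lambda>l. (a * l + b * \<alpha>) ^ k * l powr (- \<alpha> - real k))"
      using assms(1) d by (rule laplace_transform_duality_poly)
  next
    fix k and z :: real assume "a = 0" "z \<ge> 0"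
    then show "d k z = (b * \<alpha>) ^ k * (z ^ k * Gamma \<alpha> / Gamma (\<alpha> + real k))"
      using d[of z k] poly_duality_poly_zero[OF assms(1)] by simp
  next
    fix k and z :: real assume "a \<noteq> 0" "z \<ge> 0"
    then show "d k z = a ^ k * hyp1F1_neg k \<alpha> (- (b * \<alpha> / a) * z)"
      by (rule hyp)
  next
    \<comment> \<open>The sign condition forces a \<noteq> 0, so this case is a rewriting of the
      hypergeometric one with \<open>\<mu>\<close> = - (b alpha / a), which is positive
      here.\<close>
    fix k and z :: real assume "a * b < 0" "z \<ge> 0"
    then show "d k z = a ^ k * (fact k * Gamma \<alpha> / Gamma (\<alpha> + real k)) *
        laguerre k (\<alpha> - 1) (- (b * \<alpha> / a)) z"
      unfolding mult.assoc[of "a ^ k"] laguerre_eq_hyp1F1_neg[OF assms(1)] by (intro hyp) auto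
  qed (rule d1)
next
  fix \<mu> :: real and j k :: nat
  assume "\<mu> > 0" "j \<noteq> k"
  then show "has_bochner_integral (gamma_measure \<alpha> \<mu>)
    (\<lambda>z. laguerre j (\<alpha> - 1) \<mu> z * laguerre k (\<alpha> - 1) \<mu> z) 0"
    using assms(1) by (intro laguerre_orthogonal)
next
  fix d :: "nat \<Rightarrow> real \<Rightarrow> real" and a b :: real
  assume "(a = 0 \<and>
           (\<forall>k. \<forall>z\<ge>0. d k z = (b * \<alpha>) ^ k * (z ^ k * Gamma \<alpha> / Gamma (\<alpha> + real k)))) \<or>
        (a \<noteq> 0 \<and>
           (\<forall>k. \<forall>z\<ge>0. d k z = a ^ k * hyp1F1_neg k \<alpha> (- (b * \<alpha> / a) * z))) \<or>
        (a * b < 0 \<and>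
           (\<forall>k. \<forall>z\<ge>0. d k z = a ^ k * (fact k * Gamma \<alpha> / Gamma (\<alpha> + real k)) *
                              laguerre k (\<alpha> - 1) (- (b * \<alpha> / a)) z))"
  \<comment> \<open>Each of the three closed forms is brought back to the common polynomial, for
    which duality has been established.\<close>
  then have "d k t = poly (duality_poly \<alpha> a b k) t" if "t \<ge> 0" for k t
  proof (elim disjE conjE)
    assume "a = 0" "\<forall>k. \<forall>z\<ge>0. d k z = (b * \<alpha>) ^ k * (z ^ k * Gamma \<alpha> / Gamma (\<alpha> + real k))"
    then show ?thesis using poly_duality_poly_zero[OF assms(1)] that by simp
  next
    assume "a \<noteq> 0" "\<forall>k. \<forall>z\<ge>0. d k z = a ^ k * hyp1F1_neg k \<alpha> (- (b * \<alpha> / a) * z)"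
    then show ?thesis using that by (simp add: poly_duality_poly_eq_hyp1F1_neg)
  next
    assume *: "a * b < 0"
      "\<forall>k. \<forall>z\<ge>0. d k z = a ^ k * (fact k * Gamma \<alpha> / Gamma (\<alpha> + real k)) *
        laguerre k (\<alpha> - 1) (- (b * \<alpha> / a)) z"
    then have "a \<noteq> 0" by auto
    have "d k t = a ^ k * (fact k * Gamma \<alpha> / Gamma (\<alpha> + real k) * laguerre k (\<alpha> - 1) (- (b * \<alpha> / a)) t)"
      using * that by (simp add: mult.assoc)
    then show ?thesis
      unfolding laguerre_eq_hyp1F1_neg[OF assms(1)] poly_duality_poly_eq_hyp1F1_neg[OF \<open>a \<noteq> 0\<close>] .
  qed
  then show "dual_generators (sip_generator p \<alpha>) (bep_generator p \<alpha>)
    (factorized d :: ('v \<Rightarrow> nat) \<Rightarrow> ('v \<Rightarrow> real) \<Rightarrow> real)"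
    using assms(1,3) by (intro dual_generators_duality_poly)
qed

end
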